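(* Let $S$ be a numerical semigroup with multiplicity $m$ and embedding dimension $\nu$, and let $\mathrm{Ap}(S,m)=\{w_0=0<w_1<\dots<w_{m-1}\}$. Suppose that $w_{m-1}\ge w_{\alpha-1}+w_\alpha$ for some integer $\alpha$ with $1<\alpha<m-1$. If $\left(\frac{\alpha+3}{3}\right)\nu\ge m$, then $S$ satisfies Wilf's Conjecture, i.e. $f+1\le\nu n$.
   Context: A numerical semigroup is a submonoid of $(\mathbb N,+)$ with finite complement. $f$ is its Frobenius number (largest integer not in $S$), $m$ its smallest nonzero element, $\nu$ its minimal number of generators, and $n=|\{s\in S: s<f\}|$. The Apéry set is $\mathrm{Ap}(S,m)=\{s\in S: s-m\notin S\}$, which has exactly $m$ elements, listed increasingly. *)

theory Defs
  imports Complex_Main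
begin

definition add_submonoid :: "nat set \<Rightarrow> bool" where
  "add_submonoid S \<longleftrightarrow> 0 \<in> S \<and> (\<forall>a\<in>S. \<forall>b\<in>S. a + b \<in> S)"

definition numerical_semigroup :: "nat set \<Rightarrow> bool" where
  "numerical_semigroup S \<longleftrightarrow> add_submonoid S \<and> finite (UNIV - S)"

(* Integer-valued, so that the Frobenius number of the full semigroup of natural numbers is -1. *)
definition frobenius :: "nat set \<Rightarrow> int" where
  "frobenius S = (GREATEST z. z \<notin> int ` S)"

definition multiplicity_of :: "nat set \<Rightarrow> nat" where
  "multiplicity_of S = (LEAST s. s \<in> S \<and> s \<noteq> 0)"

(* add_submonoid hull A is the intersection of all submonoids containing A, that is,
   the submonoid generated by A. *)
definition embedding_dim :: "nat set \<Rightarrow> nat" where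
  "embedding_dim S = (LEAST k. \<exists>A. finite A \<and> card A = k \<and> add_submonoid hull A = S)"

definition below_frobenius :: "nat set \<Rightarrow> nat" where
  "below_frobenius S = card {s \<in> S. int s < frobenius S}"

(* The difference is taken in the integers: on nat it would truncate to 0, an element of S. *)
definition apery_set :: "nat set \<Rightarrow> nat \<Rightarrow> nat set" where
  "apery_set S m = {s \<in> S. int s - int m \<notin> int ` S}"

definition apery_elem :: "nat set \<Rightarrow> nat \<Rightarrow> nat \<Rightarrow> nat" where
  "apery_elem S m i = sorted_list_of_set (apery_set S m) ! i"

end

(* Write F = f + 1 and let c(j) be the ceiling of (F - w_j) / m (and 0 if w_j > F). The elements
   w_j + k m with k < c(j) are distinct elements of S below F, so n is at least the sum of the c(j).
   Keeping only j \<le> \<alpha> and using monotonicity gives n \<ge> q + (\<alpha> - 1) d + c with q = c(0),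
   d = c(\<alpha> - 1) \<ge> c = c(\<alpha>). The hypothesis w_(m-1) \<ge> w_(\<alpha>-1) + w_\<alpha>, together with
   w_(m-1) \<le> f + m, gives q \<le> c + d + 1, and c \<ge> 1 because w_(\<alpha>-1) \<ge> m; hence q \<le> 2 c + d.
   This yields 3 n \<ge> (\<alpha> + 3) q, so 3 \<nu> n \<ge> 3 m q \<ge> 3 F. *)
theory Submission
  imports Defs
begin

text \<open>The value at 0 is 0, so \<open>ceil_div (F - w) m\<close> with truncated subtraction
  vanishes as soon as \<open>w\<close> reaches \<open>F\<close>.\<close>

definition ceil_div :: "nat \<Rightarrow> nat \<Rightarrow> nat" where
  "ceil_div x m = (x + m - 1) div m"

lemma ceil_div_upper:
  assumes "m > 0"
  shows "x \<le> ceil_div x m * m"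
proof -
  have "x + m - 1 < (x + m - 1) div m * m + m"
    using div_mult_mod_eq[of "x + m - 1" m] mod_less_divisor[OF assms, of "x + m - 1"] by linarith
  then show ?thesis using assms unfolding ceil_div_def by linarith
qed

lemma less_ceil_div:
  assumes "m > 0" "k < ceil_div x m"
  shows "k * m < x"
proof -
  have "Suc k * m \<le> x + m - 1"
    using assms by (simp add: ceil_div_def less_eq_div_iff_mult_less_eq[symmetric] Suc_le_eq del: mult_Suc)
  then show ?thesis using assms(1) by simp
qed

lemma ceil_div_mono: "x \<le> y \<Longrightarrow> ceil_div x m \<le> ceil_div y m"
  unfolding ceil_div_def by (intro div_le_mono) simp

context
  fixes S :: "nat set"
  assumes S: "numerical_semigroup S"
begin

section \<open>Gaps and the Frobenius number\<close>

lemma zero_in: "0 \<in> S"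
  and add_in: "a \<in> S \<Longrightarrow> b \<in> S \<Longrightarrow> a + b \<in> S"
  and finite_gaps: "finite (UNIV - S)"
  using S by (auto simp: numerical_semigroup_def add_submonoid_def)

lemma frobenius_notin: "frobenius S \<notin> int ` S"
  and le_frobenius: "z \<notin> int ` S \<Longrightarrow> z \<le> frobenius S"
proof -
  let ?M = "Max (insert (-1) (int ` (UNIV - S)))"
  have fin: "finite (insert (-1) (int ` (UNIV - S)))" using finite_gaps by simp
  have in_M: "?M \<in> insert (-1) (int ` (UNIV - S))"
    by (rule Max_in[OF fin]) simp
  then have notin: "?M \<notin> int ` S" by auto
  have upper: "z \<le> ?M" if "z \<notin> int ` S" for z
  proof (cases "z < 0")
    case True
    then have "z \<le> -1" by simp
    also have "-1 \<le> ?M" using fin by (intro Max_ge) auto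
    finally show ?thesis .
  next
    case False
    then have "z = int (nat z)" by simp
    with that have "z \<in> int ` (UNIV - S)" by (metis Diff_iff UNIV_I imageI)
    then show ?thesis using fin by (intro Max_ge) auto
  qed
  have "frobenius S = ?M"
    unfolding frobenius_def by (rule Greatest_equality) (use notin upper in auto)
  then show "frobenius S \<notin> int ` S" and "z \<notin> int ` S \<Longrightarrow> z \<le> frobenius S"
    using notin upper by auto
qed

text \<open>As f is not in S, the bounds f and f + 1 cut off the same elements of S. For f = -1 both
  sets are empty.\<close>

lemma below_frobenius_eq: "below_frobenius S = card {s \<in> S. s < nat (frobenius S + 1)}"
proof -
  have "int s < frobenius S \<longleftrightarrow> s < nat (frobenius S + 1)" if "s \<in> S" for s
  proof -
    have "int s \<noteq> frobenius S" using frobenius_notin that by (metis imageI)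
    then show ?thesis by linarith
  qed
  then show ?thesis unfolding below_frobenius_def by (metis (lifting))
qed

section \<open>The Apery set and its increasing enumeration\<close>

lemma apery_set_le: "s \<in> apery_set S m \<Longrightarrow> int s \<le> frobenius S + int m"
  using le_frobenius[of "int s - int m"] by (auto simp: apery_set_def)

lemma finite_apery_set: "finite (apery_set S m)"
proof (rule finite_subset)
  show "apery_set S m \<subseteq> {..nat (frobenius S + int m)}"
    using apery_set_le by force
qed simp

lemma zero_in_apery_set: "m > 0 \<Longrightarrow> 0 \<in> apery_set S m"
  using zero_in by (auto simp: apery_set_def)

text \<open>Every residue class modulo \<open>m\<close> is infinite and so meets S; its least
  element in S belongs to the Apery set. The bound makes every index below \<open>m\<close> valid
  for \<open>apery_elem\<close>.\<close>

lemma card_apery_set_ge: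
  assumes "m > 0"
  shows "m \<le> card (apery_set S m)"
proof -
  have "{..<m} \<subseteq> (\<lambda>s. s mod m) ` apery_set S m"
  proof
    fix r assume r: "r \<in> {..<m}"
    have "inj (\<lambda>k. r + k * m)" using assms by (auto simp: inj_on_def)
    then have "infinite (range (\<lambda>k. r + k * m))" by (metis finite_imageD infinite_UNIV_nat)
    then have "\<not> range (\<lambda>k. r + k * m) \<subseteq> UNIV - S" using finite_gaps finite_subset by blast
    then obtain k where k: "r + k * m \<in> S" by auto
    define s where "s = (LEAST s. s \<in> S \<and> s mod m = r)"
    have ex: "r + k * m \<in> S \<and> (r + k * m) mod m = r" using k r by simp
    have s: "s \<in> S" "s mod m = r"
      using LeastI[of "\<lambda>s. s \<in> S \<and> s mod m = r", OF ex] unfolding s_def by auto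
    have "int s - int m \<notin> int ` S"
    proof
      assume "int s - int m \<in> int ` S"
      then obtain t where t: "t \<in> S" "s = t + m" by force
      \<comment> \<open>\<open>t\<close> lies in the same class as \<open>s\<close>, so minimality
        of \<open>s\<close> applies to it.\<close>
      then have "s \<le> t" using s(2) unfolding s_def by (intro Least_le) auto
      then show False using t assms by simp
    qed
    then show "r \<in> (\<lambda>s. s mod m) ` apery_set S m"
      using s by (auto simp: apery_set_def)
  qed
  then have "card {..<m} \<le> card (apery_set S m)"
    using finite_apery_set by (meson card_image_le card_mono finite_imageI le_trans)
  then show ?thesis by simp
qed

lemma apery_elem_in: "j < m \<Longrightarrow> apery_elem S m j \<in> apery_set S m"
  using card_apery_set_ge[of m] finite_apery_set[of m] unfolding apery_elem_def
  by (metis gr_implies_not0 gr_zeroI length_sorted_list_of_set nth_mem order_less_le_trans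
      set_sorted_list_of_set)

lemma apery_elem_less: "i < j \<Longrightarrow> j < m \<Longrightarrow> apery_elem S m i < apery_elem S m j"
  using card_apery_set_ge[of m] strict_sorted_list_of_set[of "apery_set S m"]
  unfolding apery_elem_def by (auto intro: sorted_wrt_nth_less)

lemma apery_elem_mono: "i \<le> j \<Longrightarrow> j < m \<Longrightarrow> apery_elem S m i \<le> apery_elem S m j"
  using apery_elem_less[of i j m] by (cases "i = j") auto

lemma apery_elem_0:
  assumes "m > 0"
  shows "apery_elem S m 0 = 0"
proof -
  let ?l = "sorted_list_of_set (apery_set S m)"
  have "0 \<in> set ?l" using zero_in_apery_set[OF assms] finite_apery_set by simp
  then obtain j where "j < length ?l" "?l ! j = 0" by (auto simp: in_set_conv_nth)
  then show ?thesis
    using sorted_nth_mono[of ?l 0 j] unfolding apery_elem_def by simp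
qed

section \<open>Counting elements of S below a bound\<close>

lemma add_mult_in: "a \<in> S \<Longrightarrow> b \<in> S \<Longrightarrow> a + k * b \<in> S"
proof (induction k)
  case (Suc k)
  then have "(a + k * b) + b \<in> S" using add_in by blast
  then show ?case by (simp add: ac_simps)
qed simp

lemma sum_ceil_div_le_card:
  assumes "m > 0" "m \<in> S" "p \<le> m"
  shows "(\<Sum>j<p. ceil_div (F - apery_elem S m j) m) \<le> card {s \<in> S. s < F}"
proof -
  let ?w = "apery_elem S m"
  let ?T = "SIGMA j:{..<p}. {..<ceil_div (F - ?w j) m}"
  let ?g = "\<lambda>(j, k). ?w j + k * m"
  \<comment> \<open>If k < k', then w_j - m = w_j' + (k' - k - 1) m would lie in S, against the
    choice of w_j in the Apery set.\<close>
  have no_jump: "\<not> k < k'" if eq: "?w j + k * m = ?w j' + k' * m" and "j < p" "j' < p" for j k j' k'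
  proof
    assume "k < k'"
    then obtain e where e: "k' = Suc (k + e)" using less_iff_Suc_add by auto
    have "?w j = (?w j' + e * m) + m" using eq by (simp add: e algebra_simps)
    then have "int (?w j) - int m = int (?w j' + e * m)" by simp
    moreover have "?w j' + e * m \<in> S"
      using apery_elem_in[of j' m] that assms by (intro add_mult_in) (auto simp: apery_set_def)
    moreover have "int (?w j) - int m \<notin> int ` S"
      using apery_elem_in[of j m] that assms by (simp add: apery_set_def)
    ultimately show False by (metis imageI)
  qed
  have "inj_on ?g ?T"
  proof (rule inj_onI, clarsimp)
    fix j k j' k'
    assume a: "j < p" "j' < p" "?w j + k * m = ?w j' + k' * m"
    then have "k = k'" using no_jump[of j k j' k'] no_jump[of j' k' j k] by simp
    moreover from this have "?w j = ?w j'" using a by simp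
    then have "j = j'"
      using apery_elem_less[of j j' m] apery_elem_less[of j' j m] a assms
      by (cases j j' rule: linorder_cases) auto
    ultimately show "j = j' \<and> k = k'" by simp
  qed
  moreover have "?g ` ?T \<subseteq> {s \<in> S. s < F}"
  proof clarsimp
    fix j k assume "j < p" and k: "k < ceil_div (F - ?w j) m"
    then have "?w j \<in> S" using apery_elem_in[of j m] assms by (auto simp: apery_set_def)
    then show "?w j + k * m \<in> S \<and> ?w j + k * m < F"
      using less_ceil_div[OF assms(1) k] add_mult_in assms by simp
  qed
  ultimately have "card ?T \<le> card {s \<in> S. s < F}"
    by (intro card_inj_on_le) auto
  then show ?thesis by simp
qed

section \<open>Multiplicity and the lower bound on n\<close>

lemma multiplicity_in: "multiplicity_of S \<in> S"
  and multiplicity_pos: "multiplicity_of S > 0"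
proof -
  have "infinite S" using finite_gaps by (metis finite_Diff2 infinite_UNIV_nat)
  then have "\<not> S \<subseteq> {0}" using finite_subset by blast
  then obtain s where "s \<in> S \<and> s \<noteq> 0" by blast
  from LeastI[of "\<lambda>s. s \<in> S \<and> s \<noteq> 0", OF this]
  show "multiplicity_of S \<in> S" and "multiplicity_of S > 0"
    unfolding multiplicity_of_def by auto
qed

lemma multiplicity_le: "s \<in> S \<Longrightarrow> s \<noteq> 0 \<Longrightarrow> multiplicity_of S \<le> s"
  unfolding multiplicity_of_def by (rule Least_le) simp

lemma three_below_frobenius_ge:
  fixes \<alpha> :: nat
  defines "m \<equiv> multiplicity_of S"
  assumes \<alpha>: "1 < \<alpha>" "\<alpha> < m - 1"
    and w_ge: "apery_elem S m (m - 1) \<ge> apery_elem S m (\<alpha> - 1) + apery_elem S m \<alpha>"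
  shows "(\<alpha> + 3) * ceil_div (nat (frobenius S + 1)) m \<le> 3 * below_frobenius S"
proof -
  define F where "F = nat (frobenius S + 1)"
  let ?w = "apery_elem S m"
  define q where "q = ceil_div F m"
  define d where "d = ceil_div (F - ?w (\<alpha> - 1)) m"
  define c where "c = ceil_div (F - ?w \<alpha>) m"
  have m: "m > 0" "m \<in> S" using multiplicity_pos multiplicity_in by (auto simp: m_def)
  \<comment> \<open>Here \<alpha> > 1 matters: the index \<alpha> - 1 is positive, so its Apery
    element is nonzero.\<close>
  have "?w 0 < ?w (\<alpha> - 1)" using \<alpha> by (intro apery_elem_less) auto
  moreover have "?w (\<alpha> - 1) \<in> S"
    using apery_elem_in[of "\<alpha> - 1" m] \<alpha> by (auto simp: apery_set_def)
  ultimately have x_ge: "?w (\<alpha> - 1) \<ge> m" using multiplicity_le by (simp add: m_def)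
  have "int (?w (m - 1)) \<le> frobenius S + int m"
    using m by (intro apery_set_le apery_elem_in) simp
  then have xy: "?w (\<alpha> - 1) + ?w \<alpha> + 1 \<le> F + m"
    using w_ge unfolding F_def by linarith
  have "F - ?w \<alpha> \<le> c * m" "F - ?w (\<alpha> - 1) \<le> d * m"
    unfolding c_def d_def using m by (simp_all add: ceil_div_upper)
  \<comment> \<open>If c = 0, then F \<le> w_\<alpha>, but w_(\<alpha>-1) \<ge> m and
    \<open>xy\<close> force w_\<alpha> < F.\<close>
  moreover from this(1) have c_pos: "c \<ge> 1"
    using xy x_ge by (cases "c = 0") auto
  \<comment> \<open>Adding the two bounds gives 2 F \<le> (c + d) m + w_(\<alpha>-1) + w_\<alpha>,
    and \<open>xy\<close> bounds the last two terms by F + m - 1; the -1 makes the inequality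
    strict.\<close>
  ultimately have "F < (c + d + 1) * m"
    using xy by (simp add: algebra_simps)
  then have "\<not> c + d + 1 < q"
    using less_ceil_div[OF m(1), of "c + d + 1" F] unfolding q_def by linarith
  with c_pos have q_le: "q \<le> 2 * c + d" by linarith
  have c_le_d: "c \<le> d"
    unfolding c_def d_def using \<alpha> apery_elem_mono[of "\<alpha> - 1" \<alpha> m]
    by (intro ceil_div_mono diff_le_mono2) simp
  \<comment> \<open>With b = \<alpha> - 2, the indices up to \<alpha> split into 0, the b + 1
    indices from 1 to \<alpha> - 1, each contributing at least d, and \<alpha> itself.\<close>
  obtain b where b: "\<alpha> = Suc (Suc b)"
    using \<alpha>(1) by (metis add_2_eq_Suc less_iff_Suc_add plus_1_eq_Suc add_Suc)
  let ?c = "\<lambda>j. ceil_div (F - ?w j) m"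
  have "(\<Sum>j<Suc b. d) \<le> (\<Sum>j<Suc b. ?c (Suc j))"
    unfolding d_def using \<alpha> b apery_elem_mono[of _ "\<alpha> - 1" m]
    by (intro sum_mono ceil_div_mono diff_le_mono2) simp
  then have "q + Suc b * d + c \<le> ?c 0 + (\<Sum>j<Suc b. ?c (Suc j)) + ?c \<alpha>"
    using apery_elem_0[OF m(1)] by (simp add: q_def c_def)
  also have "\<dots> = (\<Sum>j<Suc \<alpha>. ?c j)"
    unfolding b by (subst (2) sum.lessThan_Suc, subst sum.lessThan_Suc_shift) simp
  also have "\<dots> \<le> card {s \<in> S. s < F}"
    using \<alpha> m by (intro sum_ceil_div_le_card) auto
  finally have n_ge: "q + Suc b * d + c \<le> below_frobenius S"
    by (simp add: below_frobenius_eq F_def)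
  \<comment> \<open>Replacing \<alpha> q by \<alpha> (2 c + d), the difference of the two sides of
    the goal is at least (2 \<alpha> - 3) (d - c), where 2 \<alpha> - 3 = 2 b + 1.\<close>
  have "\<alpha> * q \<le> \<alpha> * (2 * c + d)" using q_le by simp
  moreover have "(2 * b + 1) * c \<le> (2 * b + 1) * d" using c_le_d by (intro mult_left_mono) auto
  ultimately have "(\<alpha> + 3) * q \<le> 3 * (q + Suc b * d + c)"
    unfolding b by (simp add: algebra_simps)
  with n_ge show ?thesis by (simp add: q_def F_def)
qed

end

theorem theorem4:
  fixes S :: "nat set" and m \<nu> \<alpha> :: nat and w :: "nat \<Rightarrow> nat"
  defines "m \<equiv> multiplicity_of S"
    and "\<nu> \<equiv> embedding_dim S"
    and "w \<equiv> apery_elem S m"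
  assumes "numerical_semigroup S"
    and "1 < \<alpha>" and "\<alpha> < m - 1"
    and "w (m - 1) \<ge> w (\<alpha> - 1) + w \<alpha>"
    and "(real \<alpha> + 3) / 3 * real \<nu> \<ge> real m"
  shows "frobenius S + 1 \<le> int \<nu> * int (below_frobenius S)"
proof -
  let ?F = "nat (frobenius S + 1)"
  let ?q = "ceil_div ?F m"
  have "real (3 * m) \<le> real ((\<alpha> + 3) * \<nu>)" using assms(8) by (simp add: field_simps)
  then have "3 * m \<le> (\<alpha> + 3) * \<nu>" by linarith
  \<comment> \<open>Scaling by q turns the hypothesis on \<nu> into 3 m q \<le> \<nu> (\<alpha> + 3)
    q, whose right side the bound on n controls.\<close>
  then have "?q * (3 * m) \<le> ?q * ((\<alpha> + 3) * \<nu>)" by (rule mult_left_mono) simp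
  also have "\<dots> = \<nu> * ((\<alpha> + 3) * ?q)" by (simp add: ac_simps)
  also have "\<dots> \<le> \<nu> * (3 * below_frobenius S)"
    using three_below_frobenius_ge[OF assms(4), of \<alpha>] assms(5-7)
    unfolding m_def w_def by (intro mult_left_mono) auto
  finally have "?q * m \<le> \<nu> * below_frobenius S" by simp
  moreover have "?F \<le> ?q * m"
    using ceil_div_upper multiplicity_pos[OF assms(4)] by (simp add: m_def)
  ultimately have "int ?F \<le> int (\<nu> * below_frobenius S)" by linarith
  then have "frobenius S + 1 \<le> int (\<nu> * below_frobenius S)" by linarith
  then show ?thesis by simp
qed

end
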